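(* Consider the sparse matrix polynomial optimization problem $$f_{\min}=\min_{x\in\mathbb{R}^n}\ f(x)=f_1(x_{\Delta_1})+\cdots+f_m(x_{\Delta_m})\quad\text{s.t.}\quad G_i(x_{\Delta_i})\succeq 0,\ i=1,\ldots,m,$$ with feasible set $K$, and assume $f_{\min}\in\mathbb{R}$. (i) For an integer $k\ge k_0$, it holds that $$f-f_{\min}\in \mathrm{QM}[G]_{spa,2k}$$ if and only if there exist sparse polynomials $p_i\in\mathbb{R}[x_{\Delta_i}]_{2k}$, $i=1,\ldots,m$, such that $$p_1+\cdots+p_m+f_{\min}=0,\qquad f_i+p_i\in \mathrm{QM}_{\Delta_i}[G_i]_{2k},\quad i=1,\ldots,m. \qquad ( * )$$ The equation in $( * )$ is equivalent to $f-f_{\min}=(f_1+p_1)+\cdots+(f_m+p_m)$. (ii) When polynomials $p_1,\ldots,p_m$ satisfy $( * )$ for some order $k$, the minimum value $f_{\min}$ is achievable (i.e., attained at some point of $K$) if and only if all the sparse polynomials $f_i+p_i$ have a common zero in $K$, i.e., there exists $u\in K$ such that $f_i(u_{\Delta_i})+p_i(u_{\Delta_i})=0$ for all $i\in[m]$.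
   Context: Let $[m]=\{1,\ldots,m\}$. $\Delta_1,\ldots,\Delta_m$ are subsets of $[n]$ with $\Delta_1\cup\cdots\cup\Delta_m=[n]$. For $x\in\mathbb{R}^n$, $x_{\Delta_i}$ is the subvector $(x_j)_{j\in\Delta_i}$. $\mathbb{R}[x_{\Delta_i}]$ is the ring of real polynomials in the variables $x_{\Delta_i}$, and $\mathbb{R}[x_{\Delta_i}]_{d}$ is its subset of polynomials of degree at most $d$. Each $f_i\in\mathbb{R}[x_{\Delta_i}]$, and each $G_i$ is an $\ell_i\times\ell_i$ symmetric matrix whose entries are polynomials in $\mathbb{R}[x_{\Delta_i}]$; $\deg(G_i)$ is the maximum degree of its entries. $X\succeq 0$ means $X$ is positive semidefinite. The feasible set is $K=\{x\in\mathbb{R}^n: G_i(x_{\Delta_i})\succeq 0,\ i=1,\ldots,m\}$, and $f_{\min}$ is the infimum of $f$ over $K$ (not assumed to be attained). $\Sigma[x_{\Delta_i}]$ is the set of sums of squares of polynomials in $\mathbb{R}[x_{\Delta_i}]$ and $\Sigma[x_{\Delta_i}]_{2k}=\Sigma[x_{\Delta_i}]\cap\mathbb{R}[x_{\Delta_i}]_{2k}$. The truncated quadratic module of $G_i$ is $$\mathrm{QM}_{\Delta_i}[G_i]_{2k}=\Sigma[x_{\Delta_i}]_{2k}+\Big\{\sum_{j=1}^sP_j^TG_iP_j:\ s\in\mathbb{N},\ P_j\in\mathbb{R}[x_{\Delta_i}]^{\ell_i},\ 2\deg(P_j)+\deg(G_i)\le 2k\Big\},$$ and $\mathrm{QM}[G]_{spa,2k}=\mathrm{QM}_{\Delta_1}[G_1]_{2k}+\cdots+\mathrm{QM}_{\Delta_m}[G_m]_{2k}$.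 The degree $k_0$ is $k_0=\max_{i\in[m]}\big(\lceil\deg(f_i)/2\rceil,\ \lceil\deg(G_i)/2\rceil\big)$. *)

theory Defs
  imports
    "HOL-Library.Poly_Mapping"
    "HOL-Library.Set_Algebras"
    "HOL-Library.Extended_Real"
    "Jordan_Normal_Form.Matrix"
begin

text \<open>Indices are zero-based: the variables are \<open>x\<^sub>0, \<dots>, x\<^bsub>n-1\<^esub>\<close>, the blocks are
  \<open>0, \<dots>, m-1\<close>. A monomial is the finitely supported map of its exponents; a polynomial maps
  monomials to coefficients, and its ring structure is the convolution product of
  \<^theory>\<open>HOL-Library.Poly_Mapping\<close>.\<close>

type_synonym rpoly = "(nat \<Rightarrow>\<^sub>0 nat) \<Rightarrow>\<^sub>0 real"

definition poly_const :: "real \<Rightarrow> rpoly" where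
  "poly_const c = Poly_Mapping.single 0 c"

definition poly_vars :: "rpoly \<Rightarrow> nat set" where
  "poly_vars p = (\<Union>a \<in> Poly_Mapping.keys p. Poly_Mapping.keys a)"

definition monom_degree :: "(nat \<Rightarrow>\<^sub>0 nat) \<Rightarrow> nat" where
  "monom_degree a = (\<Sum>j \<in> Poly_Mapping.keys a. Poly_Mapping.lookup a j)"

text \<open>Total degree, with the convention that the zero polynomial has degree 0.\<close>

definition poly_degree :: "rpoly \<Rightarrow> nat" where
  "poly_degree p = Max (insert 0 (monom_degree ` Poly_Mapping.keys p))"

definition poly_eval :: "rpoly \<Rightarrow> real vec \<Rightarrow> real" where
  "poly_eval p x = (\<Sum>a \<in> Poly_Mapping.keys p. Poly_Mapping.lookup p a *
     (\<Prod>j \<in> Poly_Mapping.keys a. (x $ j) ^ Poly_Mapping.lookup a j))"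

text \<open>\<open>\<real>[x\<^sub>D]\<close>, realised inside the ring of all polynomials. Evaluating \<open>p \<in> \<real>[x\<^sub>D]\<close> at \<open>x\<close>
  uses only the coordinates of \<open>x\<close> with index in \<open>D\<close>, so \<open>p(x\<^sub>D)\<close> is \<open>poly_eval p x\<close>.\<close>

definition poly_ring :: "nat set \<Rightarrow> rpoly set" where
  "poly_ring D = {p. poly_vars p \<subseteq> D}"

definition poly_ring_deg :: "nat set \<Rightarrow> nat \<Rightarrow> rpoly set" where
  "poly_ring_deg D d = {p \<in> poly_ring D. poly_degree p \<le> d}"

definition vec_degree :: "rpoly vec \<Rightarrow> nat" where
  "vec_degree v = Max (insert 0 (poly_degree ` set\<^sub>v v))"

definition mat_degree :: "rpoly mat \<Rightarrow> nat" where
  "mat_degree A = Max (insert 0 (poly_degree ` elements_mat A))"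

definition psd :: "real mat \<Rightarrow> bool" where
  "psd A \<longleftrightarrow> A\<^sup>T = A \<and> (\<forall>v \<in> carrier_vec (dim_row A). v \<bullet> (A *\<^sub>v v) \<ge> 0)"

definition feasible_set :: "nat \<Rightarrow> nat \<Rightarrow> (nat \<Rightarrow> rpoly mat) \<Rightarrow> real vec set" where
  "feasible_set n m G =
     {x \<in> carrier_vec n. \<forall>i<m. psd (map_mat (\<lambda>g. poly_eval g x) (G i))}"

definition SOS :: "nat set \<Rightarrow> rpoly set" where
  "SOS D = {\<Sum>j<s. (q j)\<^sup>2 | (s::nat) q. \<forall>j<s. q j \<in> poly_ring D}"

definition SOS_deg :: "nat set \<Rightarrow> nat \<Rightarrow> rpoly set" where
  "SOS_deg D d = SOS D \<inter> poly_ring_deg D d"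

text \<open>\<open>qmodule D A k\<close> is the truncation of order \<open>2k\<close>; the sum of the two sets is the Minkowski
  sum. Since a zero vector \<open>P j\<close> contributes nothing to the sum, the degree convention for 0
  is immaterial there.\<close>

definition qmodule :: "nat set \<Rightarrow> rpoly mat \<Rightarrow> nat \<Rightarrow> rpoly set" where
  "qmodule D A k = SOS_deg D (2 * k) +
     {\<Sum>j<s. P j \<bullet> (A *\<^sub>v P j) | (s::nat) P.
        \<forall>j<s. P j \<in> carrier_vec (dim_row A) \<and> set\<^sub>v (P j) \<subseteq> poly_ring D \<and>
              2 * vec_degree (P j) + mat_degree A \<le> 2 * k}"

definition sparse_qmodule ::
    "nat \<Rightarrow> (nat \<Rightarrow> nat set) \<Rightarrow> (nat \<Rightarrow> rpoly mat) \<Rightarrow> nat \<Rightarrow> rpoly set" where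
  "sparse_qmodule m \<Delta> G k = (\<Sum>i<m. qmodule (\<Delta> i) (G i) k)"

definition min_order :: "nat \<Rightarrow> (nat \<Rightarrow> rpoly) \<Rightarrow> (nat \<Rightarrow> rpoly mat) \<Rightarrow> nat" where
  "min_order m f G = Max (insert 0 ((\<lambda>i.
     max (nat \<lceil>real (poly_degree (f i)) / 2\<rceil>) (nat \<lceil>real (mat_degree (G i)) / 2\<rceil>)) ` {..<m}))"

text \<open>The infimum of the objective over the feasible set, in the extended reals
  (\<open>\<infinity>\<close> if the problem is infeasible, \<open>-\<infinity>\<close> if it is unbounded below).\<close>

definition opt_value :: "nat \<Rightarrow> nat \<Rightarrow> rpoly \<Rightarrow> (nat \<Rightarrow> rpoly mat) \<Rightarrow> ereal" where
  "opt_value n m F G = (INF x \<in> feasible_set n m G. ereal (poly_eval F x))"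

text \<open>Only the values \<open>p i\<close> with \<open>i < m\<close> matter.\<close>

definition sparse_certificate ::
    "nat \<Rightarrow> (nat \<Rightarrow> nat set) \<Rightarrow> (nat \<Rightarrow> rpoly) \<Rightarrow> (nat \<Rightarrow> rpoly mat) \<Rightarrow> real \<Rightarrow> nat \<Rightarrow>
      (nat \<Rightarrow> rpoly) \<Rightarrow> bool" where
  "sparse_certificate m \<Delta> f G c k p \<longleftrightarrow>
     (\<forall>i<m. p i \<in> poly_ring_deg (\<Delta> i) (2 * k)) \<and>
     (\<Sum>i<m. p i) + poly_const c = 0 \<and>
     (\<forall>i<m. f i + p i \<in> qmodule (\<Delta> i) (G i) k)"

end

theory Submission
  imports Defs
begin

text \<open>Three facts about polynomials carry the theorem. First, \<open>QM\<^bsub>D\<^esub>[A]\<^bsub>2k\<^esub>\<close> lies in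
  \<open>\<real>[x\<^sub>D]\<^bsub>2k\<^esub>\<close> (\<open>qmodule_subset_poly_ring_deg\<close>): sums, differences and products of polynomials in
  \<open>x\<^sub>D\<close> stay in \<open>x\<^sub>D\<close>, and degrees add under products. Second, evaluation at a point is a ring
  homomorphism. Third, the elements of \<open>QM\<^bsub>D\<^esub>[A]\<^bsub>2k\<^esub>\<close> are nonnegative wherever \<open>A\<close> is positive
  semidefinite (\<open>poly_eval_qmodule_nonneg\<close>).

  For part (i), a decomposition \<open>f - f\<^sub>m\<^sub>i\<^sub>n = s\<^sub>1 + \<dots> + s\<^sub>m\<close> with \<open>s\<^sub>i\<close> in the quadratic module of the
  \<open>i\<close>-th block is the same thing as a certificate under the change of variables \<open>p\<^sub>i = s\<^sub>i - f\<^sub>i\<close>;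
  the first fact, together with \<open>deg f\<^sub>i \<le> 2k\<close> for \<open>k \<ge> k\<^sub>0\<close>, gives the degree bound on \<open>p\<^sub>i\<close>.

  For part (ii), evaluating the decomposition at \<open>u \<in> K\<close> writes \<open>f(u) - f\<^sub>m\<^sub>i\<^sub>n\<close> as the sum of the
  numbers \<open>f\<^sub>i(u) + p\<^sub>i(u)\<close>, which are all nonnegative by the third fact. Such a sum vanishes if and
  only if every summand does, so the minimizers of \<open>f\<close> over \<open>K\<close> are precisely the common zeros in
  \<open>K\<close> of the polynomials \<open>f\<^sub>i + p\<^sub>i\<close>.\<close>

section \<open>Variables and degrees\<close>

lemma mem_poly_ring_iff:
  "p \<in> poly_ring D \<longleftrightarrow> (\<forall>a \<in> Poly_Mapping.keys p. Poly_Mapping.keys a \<subseteq> D)"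
  by (auto simp: poly_ring_def poly_vars_def)

text \<open>Membership in \<open>\<real>[x\<^sub>D]\<^sub>d\<close> is a condition on each monomial separately. This avoids any
  reasoning about the maximum in \<^const>\<open>poly_degree\<close>, so that cancellation of leading terms
  needs no attention below.\<close>

lemma mem_poly_ring_deg_iff:
  "p \<in> poly_ring_deg D d \<longleftrightarrow>
     (\<forall>a \<in> Poly_Mapping.keys p. Poly_Mapping.keys a \<subseteq> D \<and> monom_degree a \<le> d)"
  by (auto simp: poly_ring_deg_def mem_poly_ring_iff poly_degree_def)

lemma poly_ring_degI: "p \<in> poly_ring D \<Longrightarrow> poly_degree p \<le> d \<Longrightarrow> p \<in> poly_ring_deg D d"
  by (simp add: poly_ring_deg_def)

lemma poly_ring_deg_mono: "p \<in> poly_ring_deg D d \<Longrightarrow> d \<le> e \<Longrightarrow> p \<in> poly_ring_deg D e"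
  by (auto simp: poly_ring_deg_def)

lemma zero_in_poly_ring_deg: "0 \<in> poly_ring_deg D d"
  by (simp add: mem_poly_ring_deg_iff)

lemma add_in_poly_ring_deg:
  "p \<in> poly_ring_deg D d \<Longrightarrow> q \<in> poly_ring_deg D d \<Longrightarrow> p + q \<in> poly_ring_deg D d"
  using Poly_Mapping.keys_add[of p q] by (auto simp: mem_poly_ring_deg_iff)

lemma diff_in_poly_ring_deg:
  assumes "p \<in> poly_ring_deg D d" "q \<in> poly_ring_deg D d"
  shows "p - q \<in> poly_ring_deg D d"
proof -
  have "- q \<in> poly_ring_deg D d"
    using assms(2) by (simp add: mem_poly_ring_deg_iff)
  then show ?thesis
    using add_in_poly_ring_deg[OF assms(1), of "- q"] by simp
qed

lemma sum_in_poly_ring_deg: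
  "(\<And>i. i \<in> I \<Longrightarrow> p i \<in> poly_ring_deg D d) \<Longrightarrow> sum p I \<in> poly_ring_deg D d"
  by (induction I rule: infinite_finite_induct)
     (auto intro: zero_in_poly_ring_deg add_in_poly_ring_deg)

lemma keys_add_monom:
  fixes a b :: "nat \<Rightarrow>\<^sub>0 nat"
  shows "Poly_Mapping.keys (a + b) = Poly_Mapping.keys a \<union> Poly_Mapping.keys b"
  by (auto simp: in_keys_iff lookup_add)

lemma monom_degree_add: "monom_degree (a + b) = monom_degree a + monom_degree b"
  unfolding monom_degree_def by (rule setsum_keys_plus_distrib) auto

lemma mult_in_poly_ring_deg:
  assumes "p \<in> poly_ring_deg D d" "q \<in> poly_ring_deg D e"
  shows "p * q \<in> poly_ring_deg D (d + e)"
  unfolding mem_poly_ring_deg_iff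
proof
  fix c assume "c \<in> Poly_Mapping.keys (p * q)"
  then obtain a b where "c = a + b" "a \<in> Poly_Mapping.keys p" "b \<in> Poly_Mapping.keys q"
    using keys_mult[of p q] by blast
  then show "Poly_Mapping.keys c \<subseteq> D \<and> monom_degree c \<le> d + e"
    using assms by (auto simp: mem_poly_ring_deg_iff keys_add_monom monom_degree_add add_mono)
qed

lemma poly_degree_le_vec_degree:
  assumes "i < dim_vec v"
  shows "poly_degree (v $ i) \<le> vec_degree v"
  unfolding vec_degree_def using assms by (intro Max_ge) (auto simp: vec_set_def)

lemma poly_degree_le_mat_degree:
  assumes "i < dim_row A" "j < dim_col A"
  shows "poly_degree (A $$ (i, j)) \<le> mat_degree A"
proof -
  have "A $$ (i, j) \<in> elements_mat A"
    using assms by auto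
  moreover have "finite (elements_mat A)"
    by (simp add: elements_mat_def)
  ultimately show ?thesis
    unfolding mat_degree_def by (intro Max_ge) auto
qed

lemma quadratic_form_eq_double_sum:
  fixes A :: "'a :: semiring_0 mat"
  assumes "A \<in> carrier_mat l l" "P \<in> carrier_vec l"
  shows "P \<bullet> (A *\<^sub>v P) = (\<Sum>i<l. P $ i * (\<Sum>j<l. A $$ (i, j) * P $ j))"
  using assms by (auto simp: scalar_prod_def lessThan_atLeast0 intro!: sum.cong)

lemma quadratic_form_in_poly_ring_deg:
  assumes A: "A \<in> carrier_mat l l" "elements_mat A \<subseteq> poly_ring D"
    and P: "P \<in> carrier_vec l" "set\<^sub>v P \<subseteq> poly_ring D"
  shows "P \<bullet> (A *\<^sub>v P) \<in> poly_ring_deg D (2 * vec_degree P + mat_degree A)"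
proof -
  have Pi: "P $ i \<in> poly_ring_deg D (vec_degree P)" if "i < l" for i
    using that P poly_degree_le_vec_degree[of i P]
    by (intro poly_ring_degI) (auto simp: vec_set_def)
  have Aij: "A $$ (i, j) \<in> poly_ring_deg D (mat_degree A)" if "i < l" "j < l" for i j
    using that A poly_degree_le_mat_degree[of i A j]
    by (intro poly_ring_degI) auto
  have "P $ i * (\<Sum>j<l. A $$ (i, j) * P $ j)
          \<in> poly_ring_deg D (vec_degree P + (mat_degree A + vec_degree P))" if "i < l" for i
    using that by (intro mult_in_poly_ring_deg sum_in_poly_ring_deg Pi Aij) auto
  then have "P \<bullet> (A *\<^sub>v P) \<in> poly_ring_deg D (vec_degree P + (mat_degree A + vec_degree P))"
    unfolding quadratic_form_eq_double_sum[OF A(1) P(1)] by (intro sum_in_poly_ring_deg) auto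
  then show ?thesis
    by (rule poly_ring_deg_mono) simp
qed

lemma qmoduleE:
  assumes "q \<in> qmodule D A k"
  obtains \<sigma> P and s :: nat where "q = \<sigma> + (\<Sum>j<s. P j \<bullet> (A *\<^sub>v P j))" "\<sigma> \<in> SOS_deg D (2 * k)"
    "\<And>j. j < s \<Longrightarrow> P j \<in> carrier_vec (dim_row A)"
    "\<And>j. j < s \<Longrightarrow> set\<^sub>v (P j) \<subseteq> poly_ring D"
    "\<And>j. j < s \<Longrightarrow> 2 * vec_degree (P j) + mat_degree A \<le> 2 * k"
  using assms unfolding qmodule_def by (auto elim!: set_plus_elim)

lemma qmodule_subset_poly_ring_deg:
  assumes A: "A \<in> carrier_mat l l" "elements_mat A \<subseteq> poly_ring D"
  shows "qmodule D A k \<subseteq> poly_ring_deg D (2 * k)"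
proof
  fix q assume "q \<in> qmodule D A k"
  then show "q \<in> poly_ring_deg D (2 * k)"
  proof (rule qmoduleE)
    fix \<sigma> P and s :: nat
    assume q: "q = \<sigma> + (\<Sum>j<s. P j \<bullet> (A *\<^sub>v P j))" "\<sigma> \<in> SOS_deg D (2 * k)"
      and P: "\<And>j. j < s \<Longrightarrow> P j \<in> carrier_vec (dim_row A)"
        "\<And>j. j < s \<Longrightarrow> set\<^sub>v (P j) \<subseteq> poly_ring D"
        "\<And>j. j < s \<Longrightarrow> 2 * vec_degree (P j) + mat_degree A \<le> 2 * k"
    have "P j \<bullet> (A *\<^sub>v P j) \<in> poly_ring_deg D (2 * k)" if "j < s" for j
      using quadratic_form_in_poly_ring_deg[OF A, of "P j"] P[OF that] A(1)
      by (auto intro: poly_ring_deg_mono)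
    then show "q \<in> poly_ring_deg D (2 * k)"
      using q by (auto simp: SOS_deg_def intro!: add_in_poly_ring_deg sum_in_poly_ring_deg)
  qed
qed

lemma poly_degree_le_two_min_order:
  assumes "i < m"
  shows "poly_degree (f i) \<le> 2 * min_order m f G"
proof -
  have "nat \<lceil>real (poly_degree (f i)) / 2\<rceil> \<le>
      max (nat \<lceil>real (poly_degree (f i)) / 2\<rceil>) (nat \<lceil>real (mat_degree (G i)) / 2\<rceil>)"
    by simp
  also have "\<dots> \<le> min_order m f G"
    unfolding min_order_def using assms by (intro Max_ge) auto
  finally show ?thesis
    by linarith
qed

section \<open>Evaluation\<close>

lemma poly_eval_add: "poly_eval (p + q) x = poly_eval p x + poly_eval q x"
  unfolding poly_eval_def by (rule setsum_keys_plus_distrib) (auto simp: distrib_right)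

lemma poly_eval_zero: "poly_eval 0 x = 0"
  by (simp add: poly_eval_def)

lemma poly_eval_sum: "poly_eval (sum p I) x = (\<Sum>i\<in>I. poly_eval (p i) x)"
  by (induction I rule: infinite_finite_induct) (simp_all add: poly_eval_zero poly_eval_add)

lemma poly_eval_const: "poly_eval (poly_const c) x = c"
  by (simp add: poly_eval_def poly_const_def)

lemma poly_eval_diff: "poly_eval (p - q) x = poly_eval p x - poly_eval q x"
  using poly_eval_add[of "p - q" q x] by simp

definition monom_eval :: "(nat \<Rightarrow>\<^sub>0 nat) \<Rightarrow> real vec \<Rightarrow> real" where
  "monom_eval a x = (\<Prod>j \<in> Poly_Mapping.keys a. (x $ j) ^ Poly_Mapping.lookup a j)"

lemma poly_eval_single: "poly_eval (Poly_Mapping.single a c) x = c * monom_eval a x"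
  by (simp add: poly_eval_def monom_eval_def)

text \<open>Factors with exponent \<open>0\<close> equal \<open>1\<close>, even for a coordinate that is \<open>0\<close>. The products for
  \<open>a\<close>, \<open>b\<close> and \<open>a + b\<close> can thus be taken over one common index set and multiplied factor by
  factor.\<close>

lemma monom_eval_superset:
  assumes "finite S" "Poly_Mapping.keys a \<subseteq> S"
  shows "monom_eval a x = (\<Prod>j\<in>S. (x $ j) ^ Poly_Mapping.lookup a j)"
  unfolding monom_eval_def using assms
  by (intro prod.mono_neutral_left) (auto simp: in_keys_iff)

lemma monom_eval_add: "monom_eval (a + b) x = monom_eval a x * monom_eval b x"
proof -
  let ?S = "Poly_Mapping.keys a \<union> Poly_Mapping.keys b"
  have "monom_eval c x = (\<Prod>j\<in>?S. (x $ j) ^ Poly_Mapping.lookup c j)"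
    if "c \<in> {a, b, a + b}" for c
    using that by (intro monom_eval_superset) (auto simp: keys_add_monom)
  then show ?thesis
    by (simp add: lookup_add power_add prod.distrib)
qed

lemma poly_eq_sum_single:
  fixes p :: rpoly
  shows "p = (\<Sum>a \<in> Poly_Mapping.keys p. Poly_Mapping.single a (Poly_Mapping.lookup p a))"
  by (rule poly_mapping_eqI)
     (auto simp: lookup_sum lookup_single when_def in_keys_iff)

lemma poly_eval_mult: "poly_eval (p * q) x = poly_eval p x * poly_eval q x"
proof -
  let ?s = "\<lambda>p a. Poly_Mapping.single a (Poly_Mapping.lookup (p :: rpoly) a)"
  have "p * q = (\<Sum>a \<in> Poly_Mapping.keys p. ?s p a) * (\<Sum>b \<in> Poly_Mapping.keys q. ?s q b)"
    using poly_eq_sum_single[of p] poly_eq_sum_single[of q] by simp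
  also have "\<dots> = (\<Sum>a \<in> Poly_Mapping.keys p. \<Sum>b \<in> Poly_Mapping.keys q. ?s p a * ?s q b)"
    by (rule sum_product)
  finally have "poly_eval (p * q) x =
      (\<Sum>a \<in> Poly_Mapping.keys p. \<Sum>b \<in> Poly_Mapping.keys q.
        (Poly_Mapping.lookup p a * monom_eval a x) * (Poly_Mapping.lookup q b * monom_eval b x))"
    by (simp add: poly_eval_sum mult_single poly_eval_single monom_eval_add mult_ac)
  also have "\<dots> = poly_eval p x * poly_eval q x"
    by (simp add: sum_product poly_eval_def monom_eval_def)
  finally show ?thesis .
qed

lemma poly_eval_SOS_nonneg: "\<sigma> \<in> SOS D \<Longrightarrow> poly_eval \<sigma> x \<ge> 0"
  by (auto simp: SOS_def poly_eval_sum power2_eq_square poly_eval_mult intro!: sum_nonneg)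

text \<open>Evaluation commutes with the quadratic form: \<open>(P\<^sup>T A P)(x) = P(x)\<^sup>T A(x) P(x)\<close>, which is
  nonnegative when the real matrix \<open>A(x)\<close> is positive semidefinite.\<close>

lemma poly_eval_quadratic_form_nonneg:
  assumes A: "A \<in> carrier_mat l l" and P: "P \<in> carrier_vec l"
    and psd: "psd (map_mat (\<lambda>g. poly_eval g x) A)"
  shows "poly_eval (P \<bullet> (A *\<^sub>v P)) x \<ge> 0"
proof -
  let ?A = "map_mat (\<lambda>g. poly_eval g x) A" and ?P = "map_vec (\<lambda>g. poly_eval g x) P"
  have "poly_eval (P \<bullet> (A *\<^sub>v P)) x =
      (\<Sum>i<l. poly_eval (P $ i) x * (\<Sum>j<l. poly_eval (A $$ (i, j)) x * poly_eval (P $ j) x))"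
    by (simp add: quadratic_form_eq_double_sum[OF A P] poly_eval_sum poly_eval_mult)
  also have "\<dots> = ?P \<bullet> (?A *\<^sub>v ?P)"
    using A P by (subst quadratic_form_eq_double_sum[of _ l]) auto
  also have "\<dots> \<ge> 0"
    using psd A P by (simp add: psd_def)
  finally show ?thesis .
qed

lemma poly_eval_qmodule_nonneg:
  assumes A: "A \<in> carrier_mat l l" and psd: "psd (map_mat (\<lambda>g. poly_eval g x) A)"
    and "q \<in> qmodule D A k"
  shows "poly_eval q x \<ge> 0"
  using assms(3)
proof (rule qmoduleE)
  fix \<sigma> P and s :: nat
  assume q: "q = \<sigma> + (\<Sum>j<s. P j \<bullet> (A *\<^sub>v P j))" "\<sigma> \<in> SOS_deg D (2 * k)"
    and P: "\<And>j. j < s \<Longrightarrow> P j \<in> carrier_vec (dim_row A)"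
  have "poly_eval (P j \<bullet> (A *\<^sub>v P j)) x \<ge> 0" if "j < s" for j
    using P[OF that] A by (intro poly_eval_quadratic_form_nonneg[OF A _ psd]) simp
  then show ?thesis
    using q poly_eval_SOS_nonneg[of \<sigma> D x]
    by (auto simp: poly_eval_add poly_eval_sum SOS_deg_def intro!: add_nonneg_nonneg sum_nonneg)
qed

section \<open>Sparse certificates\<close>

lemma certificate_sum_iff:
  "(\<Sum>i<m. p i) + poly_const c = 0 \<longleftrightarrow>
     (\<Sum>i<m. f i) - poly_const c = (\<Sum>i<m. f i + p i)"
  by (auto simp: sum.distrib algebra_simps add_eq_0_iff)

lemma sparse_qmodule_iff_certificate:
  assumes f: "\<And>i. i < m \<Longrightarrow> f i \<in> poly_ring (\<Delta> i)"
    and G: "\<And>i. i < m \<Longrightarrow> G i \<in> carrier_mat (l i) (l i)"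
      "\<And>i. i < m \<Longrightarrow> elements_mat (G i) \<subseteq> poly_ring (\<Delta> i)"
    and k: "k \<ge> min_order m f G"
  shows "(\<Sum>i<m. f i) - poly_const c \<in> sparse_qmodule m \<Delta> G k \<longleftrightarrow>
    (\<exists>p. sparse_certificate m \<Delta> f G c k p)"
proof
  assume "(\<Sum>i<m. f i) - poly_const c \<in> sparse_qmodule m \<Delta> G k"
  then obtain s where s: "(\<Sum>i<m. f i) - poly_const c = (\<Sum>i<m. s i)"
      "\<And>i. i < m \<Longrightarrow> s i \<in> qmodule (\<Delta> i) (G i) k"
    by (auto simp: sparse_qmodule_def set_sum_alt)
  have "s i - f i \<in> poly_ring_deg (\<Delta> i) (2 * k)" if i: "i < m" for i
  proof (rule diff_in_poly_ring_deg)
    show "s i \<in> poly_ring_deg (\<Delta> i) (2 * k)"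
      using s(2)[OF i] qmodule_subset_poly_ring_deg[OF G(1)[OF i] G(2)[OF i]] by blast
    show "f i \<in> poly_ring_deg (\<Delta> i) (2 * k)"
      using f[OF i] poly_degree_le_two_min_order[OF i, of f G] k by (intro poly_ring_degI) auto
  qed
  moreover have "(\<Sum>i<m. s i - f i) + poly_const c = 0"
    using s(1) by (simp add: certificate_sum_iff[where f = f])
  ultimately have "sparse_certificate m \<Delta> f G c k (\<lambda>i. s i - f i)"
    using s(2) by (simp add: sparse_certificate_def)
  then show "\<exists>p. sparse_certificate m \<Delta> f G c k p"
    by blast
next
  assume "\<exists>p. sparse_certificate m \<Delta> f G c k p"
  then obtain p where "(\<Sum>i<m. f i) - poly_const c = (\<Sum>i<m. f i + p i)"
      "\<forall>i<m. f i + p i \<in> qmodule (\<Delta> i) (G i) k"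
    by (auto simp: sparse_certificate_def certificate_sum_iff[where f = f])
  then show "(\<Sum>i<m. f i) - poly_const c \<in> sparse_qmodule m \<Delta> G k"
    by (auto simp: sparse_qmodule_def set_sum_alt)
qed

text \<open>At \<open>u \<in> K\<close> the numbers \<open>f\<^sub>i(u) + p\<^sub>i(u)\<close> are nonnegative and add up to \<open>f(u) - c\<close>. The
  equivalence holds pointwise on \<open>K\<close>, so a minimizer is itself a common zero.\<close>

lemma attained_iff_common_zero:
  assumes G: "\<And>i. i < m \<Longrightarrow> G i \<in> carrier_mat (l i) (l i)"
    and cert: "sparse_certificate m \<Delta> f G c k p" and u: "u \<in> feasible_set n m G"
  shows "poly_eval (\<Sum>i<m. f i) u = c \<longleftrightarrow> (\<forall>i<m. poly_eval (f i) u + poly_eval (p i) u = 0)"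
proof -
  have "(\<Sum>i<m. f i) - poly_const c = (\<Sum>i<m. f i + p i)"
    using cert by (simp add: sparse_certificate_def certificate_sum_iff[where f = f])
  then have "poly_eval ((\<Sum>i<m. f i) - poly_const c) u = poly_eval (\<Sum>i<m. f i + p i) u"
    by simp
  then have *: "poly_eval (\<Sum>i<m. f i) u - c = (\<Sum>i<m. poly_eval (f i + p i) u)"
    by (simp only: poly_eval_diff poly_eval_const poly_eval_sum)
  have "poly_eval (f i + p i) u \<ge> 0" if "i < m" for i
    using that cert u
    by (intro poly_eval_qmodule_nonneg[OF G[OF that]])
       (auto simp: sparse_certificate_def feasible_set_def)
  then have "(\<Sum>i<m. poly_eval (f i + p i) u) = 0 \<longleftrightarrow> (\<forall>i<m. poly_eval (f i + p i) u = 0)"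
    by (subst sum_nonneg_eq_0_iff) auto
  moreover have "poly_eval (\<Sum>i<m. f i) u = c \<longleftrightarrow> (\<Sum>i<m. poly_eval (f i + p i) u) = 0"
    using * by linarith
  ultimately show ?thesis
    by (simp add: poly_eval_add)
qed

theorem theorem3p1:
  fixes n m :: nat
    and \<Delta> :: "nat \<Rightarrow> nat set"
    and l :: "nat \<Rightarrow> nat"
    and f :: "nat \<Rightarrow> rpoly"
    and G :: "nat \<Rightarrow> rpoly mat"
    and f_min :: real
  assumes "(\<Union>i<m. \<Delta> i) = {..<n}"
    and "\<And>i. i < m \<Longrightarrow> f i \<in> poly_ring (\<Delta> i)"
    and "\<And>i. i < m \<Longrightarrow> G i \<in> carrier_mat (l i) (l i)"
    and "\<And>i. i < m \<Longrightarrow> (G i)\<^sup>T = G i"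
    and "\<And>i. i < m \<Longrightarrow> elements_mat (G i) \<subseteq> poly_ring (\<Delta> i)"
    and "opt_value n m (\<Sum>i<m. f i) G = ereal f_min"
  shows
    "(\<forall>k \<ge> min_order m f G.
        (\<Sum>i<m. f i) - poly_const f_min \<in> sparse_qmodule m \<Delta> G k \<longleftrightarrow>
        (\<exists>p. sparse_certificate m \<Delta> f G f_min k p)) \<and>
     (\<forall>p. (\<forall>i<m. p i \<in> poly_ring (\<Delta> i)) \<longrightarrow>
        ((\<Sum>i<m. p i) + poly_const f_min = 0 \<longleftrightarrow>
         (\<Sum>i<m. f i) - poly_const f_min = (\<Sum>i<m. f i + p i))) \<and>
     (\<forall>k p. sparse_certificate m \<Delta> f G f_min k p \<longrightarrow>
        ((\<exists>u \<in> feasible_set n m G. poly_eval (\<Sum>i<m. f i) u = f_min) \<longleftrightarrow>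
         (\<exists>u \<in> feasible_set n m G. \<forall>i<m. poly_eval (f i) u + poly_eval (p i) u = 0)))"
proof (intro conjI)
  show "\<forall>k \<ge> min_order m f G.
      (\<Sum>i<m. f i) - poly_const f_min \<in> sparse_qmodule m \<Delta> G k \<longleftrightarrow>
      (\<exists>p. sparse_certificate m \<Delta> f G f_min k p)"
    using sparse_qmodule_iff_certificate[where f = f and G = G and \<Delta> = \<Delta>, OF assms(2,3,5)]
    by blast
  show "\<forall>p. (\<forall>i<m. p i \<in> poly_ring (\<Delta> i)) \<longrightarrow>
      ((\<Sum>i<m. p i) + poly_const f_min = 0 \<longleftrightarrow>
       (\<Sum>i<m. f i) - poly_const f_min = (\<Sum>i<m. f i + p i))"
    using certificate_sum_iff by blast
  show "\<forall>k p. sparse_certificate m \<Delta> f G f_min k p \<longrightarrow>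
      ((\<exists>u \<in> feasible_set n m G. poly_eval (\<Sum>i<m. f i) u = f_min) \<longleftrightarrow>
       (\<exists>u \<in> feasible_set n m G. \<forall>i<m. poly_eval (f i) u + poly_eval (p i) u = 0))"
    using attained_iff_common_zero[where G = G, OF assms(3)] by blast
qed

end
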